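(* Let $X$ be a set, let $S$ be a binary relation on $\mathfrak{M}(X)$, let $\leq$ be a monomial order on $\mathfrak{M}(X)$, and let $\Pi_S$ be the term-rewriting system associated to $S$ with respect to $\leq$. Then $\mathrm{Irr}(S)$ is a section of $\langle S\rangle$ if and only if $\Pi_S$ is convergent.
   Context: Free operated monoid: for a set $Y$, $M(Y)$ is the free monoid on $Y$, with identity $1$. For a set $X$ put $\mathfrak{M}_0(X)=M(X)$ and $\mathfrak{M}_{n+1}(X)=M(X\cup\lfloor \mathfrak{M}_n(X)\rfloor)$, where $\lfloor \mathfrak{M}_n(X)\rfloor=\{\lfloor u\rfloor\mid u\in \mathfrak{M}_n(X)\}$ is a disjoint copy of $\mathfrak{M}_n(X)$; via the natural embeddings $\mathfrak{M}_n(X)\hookrightarrow\mathfrak{M}_{n+1}(X)$ let $\mathfrak{M}(X)=\bigcup_{n\ge 0}\mathfrak{M}_n(X)$. Its elements are called bracketed words on $X$. It is a monoid equipped with the operator $w\mapsto\lfloor w\rfloor$, and it is the free operated monoid on $X$ (an operated monoid is a monoid together with a map from it to itself). $\star$-bracketed words: for a symbol $\star\notin X$, $\mathfrak{M}^\star(X)$ is the set of bracketed words on $X\cup\{\star\}$ with exactly one occurrence of $\star$; $q|_u$ is obtained from $q\in\mathfrak{M}^\star(X)$ by replacing $\star$ by $u$. Operated congruence: an equivalence relation $R$ on $\mathfrak{M}(X)$ such that $(a,b)\in R$ implies $(ac,bc)\in R$, $(ca,cb)\in R$ and $(\lfloor a\rfloor,\lfloor b\rfloor)\in R$ for all $a,b,c\in\mathfrak{M}(X)$.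 $\langle S\rangle$ is the smallest operated congruence containing $S$. A section of an operated congruence $R$ is a subset $W\subseteq\mathfrak{M}(X)$ containing exactly one element of each $R$-class. Monomial order: a well-ordering $\leq$ (total) on $\mathfrak{M}(X)$ such that $u<v$ implies $uw<vw$, $wu<wv$ and $\lfloor u\rfloor<\lfloor v\rfloor$ for all $u,v,w\in\mathfrak{M}(X)$. Rewriting: with $S^{-1}=\{(b,a)\mid(a,b)\in S\}$, set $\Pi_S=\{(q|_t,q|_v)\mid q\in\mathfrak{M}^\star(X),\ (t,v)\in S\cup S^{-1},\ t>v\}$. Write $f\to_{\Pi_S} g$ if $(f,g)\in\Pi_S$, and $\overset{*}{\to}_{\Pi_S}$ for the reflexive transitive closure. $f,g$ are joinable if there is $h$ with $f\overset{*}{\to}_{\Pi_S}h$ and $g\overset{*}{\to}_{\Pi_S}h$. $\Pi_S$ is terminating if there is no infinite chain $f_0\to_{\Pi_S}f_1\to_{\Pi_S}\cdots$; confluent if whenever $f\overset{*}{\to}_{\Pi_S}g$ and $f\overset{*}{\to}_{\Pi_S}h$, the elements $g,h$ are joinable; convergent if both terminating and confluent. $\mathrm{Dom}(\Pi_S)$ is the set of first components of elements of $\Pi_S$, and $\mathrm{Irr}(S)=\mathfrak{M}(X)\setminus\mathrm{Dom}(\Pi_S)$. *)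

theory Defs
  imports Main
begin

section \<open>Bracketed words\<close>

text \<open>
  A bracketed word is a finite list of letters, each of which is a generator or a bracketed
  bracketed word. The unit is the empty list, the product is list concatenation and the
  operator is \<open>brk\<close>. The natural embeddings between the stages of the construction become
  inclusions of sets of lists. The set of generators is an explicit, possibly empty, set.
\<close>

datatype 'x letter = Gen 'x | Brk "'x letter list"

type_synonym 'x bword = "'x letter list"

definition brk :: "'x bword \<Rightarrow> 'x bword" where
  "brk w = [Brk w]"

primrec bwords_stage :: "nat \<Rightarrow> 'x set \<Rightarrow> 'x bword set" where
  "bwords_stage 0 X = lists (Gen ` X)"
| "bwords_stage (Suc n) X = lists (Gen ` X \<union> Brk ` bwords_stage n X)"

definition bwords :: "'x set \<Rightarrow> 'x bword set" where
  "bwords X = (\<Union>n. bwords_stage n X)"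


section \<open>Star-bracketed words\<close>

text \<open>The symbol \<open>\<star>\<close> is \<open>None\<close>, and an element \<open>x\<close> of \<open>X\<close> is \<open>Some x\<close>.\<close>

fun star_count_letter :: "'x option letter \<Rightarrow> nat"
  and star_count :: "'x option bword \<Rightarrow> nat" where
  "star_count_letter (Gen None) = 1"
| "star_count_letter (Gen (Some x)) = 0"
| "star_count_letter (Brk w) = star_count w"
| "star_count [] = 0"
| "star_count (l # w) = star_count_letter l + star_count w"

definition star_bwords :: "'x set \<Rightarrow> 'x option bword set" where
  "star_bwords X = {q \<in> bwords (insert None (Some ` X)). star_count q = 1}"

text \<open>\<open>plug q u\<close> is \<open>q|\<^sub>u\<close>.\<close>

fun plug_letter :: "'x option letter \<Rightarrow> 'x bword \<Rightarrow> 'x bword"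
  and plug :: "'x option bword \<Rightarrow> 'x bword \<Rightarrow> 'x bword" where
  "plug_letter (Gen None) u = u"
| "plug_letter (Gen (Some x)) u = [Gen x]"
| "plug_letter (Brk w) u = brk (plug w u)"
| "plug [] u = []"
| "plug (l # w) u = plug_letter l u @ plug w u"


section \<open>Operated congruences and sections\<close>

definition operated_congruence :: "'x set \<Rightarrow> 'x bword rel \<Rightarrow> bool" where
  "operated_congruence X R \<longleftrightarrow>
     equiv (bwords X) R \<and>
     (\<forall>a \<in> bwords X. \<forall>b \<in> bwords X. \<forall>c \<in> bwords X. (a, b) \<in> R \<longrightarrow>
        (a @ c, b @ c) \<in> R \<and> (c @ a, c @ b) \<in> R \<and> (brk a, brk b) \<in> R)"

definition generated_congruence :: "'x set \<Rightarrow> 'x bword rel \<Rightarrow> 'x bword rel" where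
  "generated_congruence X S = \<Inter> {R. operated_congruence X R \<and> S \<subseteq> R}"

definition is_section :: "'x set \<Rightarrow> 'x bword rel \<Rightarrow> 'x bword set \<Rightarrow> bool" where
  "is_section X R W \<longleftrightarrow> W \<subseteq> bwords X \<and> (\<forall>C \<in> bwords X // R. \<exists>!w. w \<in> C \<and> w \<in> W)"


section \<open>Monomial orders\<close>

text \<open>An order is the set of pairs \<open>(u, v)\<close> with \<open>u \<le> v\<close>.\<close>

definition less_in :: "'a rel \<Rightarrow> 'a \<Rightarrow> 'a \<Rightarrow> bool" where
  "less_in le u v \<longleftrightarrow> (u, v) \<in> le \<and> u \<noteq> v"

definition monomial_order :: "'x set \<Rightarrow> 'x bword rel \<Rightarrow> bool" where
  "monomial_order X le \<longleftrightarrow>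
     well_order_on (bwords X) le \<and>
     (\<forall>u \<in> bwords X. \<forall>v \<in> bwords X. \<forall>w \<in> bwords X. less_in le u v \<longrightarrow>
        less_in le (u @ w) (v @ w) \<and> less_in le (w @ u) (w @ v) \<and>
        less_in le (brk u) (brk v))"


section \<open>Rewriting\<close>

definition rewrite_system :: "'x set \<Rightarrow> 'x bword rel \<Rightarrow> 'x bword rel \<Rightarrow> 'x bword rel" where
  "rewrite_system X le S =
     {(plug q t, plug q v) | q t v.
        q \<in> star_bwords X \<and> (t, v) \<in> S \<union> S\<inverse> \<and> less_in le v t}"

definition Irr :: "'x set \<Rightarrow> 'x bword rel \<Rightarrow> 'x bword rel \<Rightarrow> 'x bword set" where
  "Irr X le S = bwords X - Domain (rewrite_system X le S)"

text \<open>
  The following notions quantify over the whole type. For a relation on a subset this agrees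
  with quantifying over the subset, as no element outside it can be rewritten or reached by a
  rewriting step.
\<close>

definition joinable :: "'a rel \<Rightarrow> 'a \<Rightarrow> 'a \<Rightarrow> bool" where
  "joinable P f g \<longleftrightarrow> (\<exists>h. (f, h) \<in> P\<^sup>* \<and> (g, h) \<in> P\<^sup>*)"

definition terminating :: "'a rel \<Rightarrow> bool" where
  "terminating P \<longleftrightarrow> \<not> (\<exists>f :: nat \<Rightarrow> 'a. \<forall>i. (f i, f (Suc i)) \<in> P)"

definition confluent :: "'a rel \<Rightarrow> bool" where
  "confluent P \<longleftrightarrow> (\<forall>f g h. (f, g) \<in> P\<^sup>* \<longrightarrow> (f, h) \<in> P\<^sup>* \<longrightarrow> joinable P g h)"

definition convergent :: "'a rel \<Rightarrow> bool" where
  "convergent P \<longleftrightarrow> terminating P \<and> confluent P"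

end

theory Submission
  imports Defs
begin

text \<open>
  The conversion relation of the rewriting system, restricted to bracketed words, is exactly the
  generated congruence: the rewriting relation is closed under contexts, and a total order orients
  every nontrivial pair of the given relation. Every rewriting step descends in the monomial
  order, so rewriting terminates and every congruence class contains an irreducible element.
  Confluence is then equivalent, by the Church-Rosser property, to its uniqueness.
\<close>

section \<open>Bracketed words: closure properties and description by generators\<close>

lemma bwords_stage_Suc_mono: "bwords_stage n X \<subseteq> bwords_stage (Suc n) X"
proof (induction n)
  case 0
  show ?case by (simp add: lists_mono)
next
  case (Suc n)
  then have "Gen ` X \<union> Brk ` bwords_stage n X \<subseteq> Gen ` X \<union> Brk ` bwords_stage (Suc n) X"
    by blast
  then show ?case
    unfolding bwords_stage.simps(2)[of n X] bwords_stage.simps(2)[of "Suc n" X]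
    by (rule lists_mono)
qed

lemma bwords_stage_mono: "m \<le> n \<Longrightarrow> bwords_stage m X \<subseteq> bwords_stage n X"
  by (rule lift_Suc_mono_le[of "\<lambda>n. bwords_stage n X"]) (rule bwords_stage_Suc_mono)

lemma bwords_stage_append:
  "u \<in> bwords_stage n X \<Longrightarrow> v \<in> bwords_stage n X \<Longrightarrow> u @ v \<in> bwords_stage n X"
  by (cases n) auto

lemma bwords_append: "u \<in> bwords X \<Longrightarrow> v \<in> bwords X \<Longrightarrow> u @ v \<in> bwords X"
proof -
  assume "u \<in> bwords X" "v \<in> bwords X"
  then obtain m n where "u \<in> bwords_stage m X" "v \<in> bwords_stage n X"
    by (auto simp: bwords_def)
  then have "u @ v \<in> bwords_stage (max m n) X"
    using bwords_stage_mono[of m "max m n" X] bwords_stage_mono[of n "max m n" X]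
    by (intro bwords_stage_append) auto
  then show ?thesis
    by (auto simp: bwords_def)
qed

lemma bwords_Nil: "[] \<in> bwords X"
  by (auto simp: bwords_def intro!: exI[of _ 0])

lemma bwords_brk: "w \<in> bwords X \<Longrightarrow> brk w \<in> bwords X"
proof -
  assume "w \<in> bwords X"
  then obtain n where "w \<in> bwords_stage n X"
    by (auto simp: bwords_def)
  then have "brk w \<in> bwords_stage (Suc n) X"
    by (simp add: brk_def)
  then show ?thesis
    unfolding bwords_def by blast
qed

lemma bwords_Gen: "x \<in> X \<Longrightarrow> [Gen x] \<in> bwords X"
  by (auto simp: bwords_def intro!: exI[of _ 0])

lemma bwords_if_letters:
  assumes "\<And>l. l \<in> set w \<Longrightarrow> [l] \<in> bwords X"
  shows "w \<in> bwords X"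
  using assms
proof (induction w)
  case Nil
  show ?case by (rule bwords_Nil)
next
  case (Cons l w)
  then show ?case using bwords_append[of "[l]" X w] by simp
qed

text \<open>Structural induction avoids stage indices: in the bracket case the letters of the
  content are singleton words in \<open>bwords X\<close>, and the content is their product.\<close>

lemma singleton_bwords_if_set_letter: "set_letter l \<subseteq> X \<Longrightarrow> [l] \<in> bwords X"
proof (induction l)
  case (Gen x)
  then show ?case by (simp add: bwords_Gen)
next
  case (Brk w)
  then have "w \<in> bwords X"
    by (auto intro: bwords_if_letters[of w])
  then show ?case using bwords_brk[of w X] by (simp add: brk_def)
qed

lemma set_letter_if_bwords_stage:
  "w \<in> bwords_stage n X \<Longrightarrow> l \<in> set w \<Longrightarrow> set_letter l \<subseteq> X"
proof (induction n arbitrary: w l)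
  case 0
  then show ?case by auto
next
  case (Suc n)
  then have "l \<in> Gen ` X \<union> Brk ` bwords_stage n X"
    by auto
  then show ?case
    using Suc.IH by fastforce
qed

text \<open>Nesting is finite, so every word over \<open>X\<close> lies in some stage. This replaces
  the staged construction by a condition on generators that suits structural induction.\<close>

lemma bwords_iff: "w \<in> bwords X \<longleftrightarrow> (\<forall>l \<in> set w. set_letter l \<subseteq> X)"
proof
  assume "w \<in> bwords X"
  then show "\<forall>l \<in> set w. set_letter l \<subseteq> X"
    using set_letter_if_bwords_stage unfolding bwords_def by blast
next
  assume "\<forall>l \<in> set w. set_letter l \<subseteq> X"
  then show "w \<in> bwords X"
    by (simp add: bwords_if_letters[of w] singleton_bwords_if_set_letter)
qed

section \<open>Contexts and the embedding of star-free words\<close>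

definition embed :: "'x bword \<Rightarrow> 'x option bword" where
  "embed = map (map_letter Some)"

lemma embed_bwords: "w \<in> bwords X \<Longrightarrow> embed w \<in> bwords (insert None (Some ` X))"
  by (fastforce simp: bwords_iff embed_def letter.set_map)

lemma star_count_append: "star_count (p @ q) = star_count p + star_count q"
  by (induction p) auto

lemma plug_append: "plug (p @ q) u = plug p u @ plug q u"
  by (induction p) auto

lemma star_count_eq_0: "(\<And>l. l \<in> set q \<Longrightarrow> star_count_letter l = 0) \<Longrightarrow> star_count q = 0"
  by (induction q) auto

lemma star_count_letter_map_Some: "star_count_letter (map_letter Some l) = 0"
  by (induction l) (auto intro!: star_count_eq_0)

lemma star_count_embed: "star_count (embed w) = 0"
  by (auto simp: embed_def star_count_letter_map_Some intro!: star_count_eq_0)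

text \<open>The hypothesis is letterwise to match the induction hypothesis that the nested datatype
  gives for the content of a bracket.\<close>

lemma plug_map:
  "(\<And>l. l \<in> set w \<Longrightarrow> plug_letter (f l) u = [l]) \<Longrightarrow> plug (map f w) u = w"
  by (induction w) auto

lemma plug_letter_map_Some: "plug_letter (map_letter Some l) u = [l]"
  by (induction l) (auto simp: brk_def plug_map)

lemma plug_embed: "plug (embed w) u = w"
  by (simp add: embed_def plug_map plug_letter_map_Some)

lemma star_bwords_star: "[Gen None] \<in> star_bwords X"
  by (simp add: star_bwords_def bwords_Gen)

text \<open>A constant factor enters a context through \<open>embed\<close>, which contributes no
  star and is left fixed by \<open>plug\<close>.\<close>

lemma star_bwords_append_right:
  "q \<in> star_bwords X \<Longrightarrow> w \<in> bwords X \<Longrightarrow> q @ embed w \<in> star_bwords X"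
  by (simp add: star_bwords_def bwords_append embed_bwords star_count_append star_count_embed)

lemma star_bwords_append_left:
  "q \<in> star_bwords X \<Longrightarrow> w \<in> bwords X \<Longrightarrow> embed w @ q \<in> star_bwords X"
  by (simp add: star_bwords_def bwords_append embed_bwords star_count_append star_count_embed)

lemma star_bwords_brk: "q \<in> star_bwords X \<Longrightarrow> brk q \<in> star_bwords X"
  using bwords_brk[of q] by (simp add: star_bwords_def brk_def)

section \<open>Compatible relations, rewriting steps and the generated congruence\<close>

definition op_compatible :: "'x set \<Rightarrow> 'x bword rel \<Rightarrow> bool" where
  "op_compatible X R \<longleftrightarrow>
     (\<forall>a \<in> bwords X. \<forall>b \<in> bwords X. \<forall>c \<in> bwords X. (a, b) \<in> R \<longrightarrow>
        (a @ c, b @ c) \<in> R \<and> (c @ a, c @ b) \<in> R \<and> (brk a, brk b) \<in> R)"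

text \<open>Separates the compatibility axioms from equivalence, so that they can also be asked of a
  single rewriting step or of the reversed strict order.\<close>

lemma operated_congruence_iff:
  "operated_congruence X R \<longleftrightarrow> equiv (bwords X) R \<and> op_compatible X R"
  by (simp add: operated_congruence_def op_compatible_def)

lemma plug_star_free:
  "star_count_letter l = 0 \<Longrightarrow> plug_letter l t = plug_letter l v"
  "star_count q = 0 \<Longrightarrow> plug q t = plug q v"
  by (induction l and q rule: star_count_letter_star_count.induct) auto

lemma plug_bwords:
  assumes "u \<in> bwords X"
  shows "set_letter l \<subseteq> insert None (Some ` X) \<Longrightarrow> plug_letter l u \<in> bwords X"
    and "q \<in> bwords (insert None (Some ` X)) \<Longrightarrow> plug q u \<in> bwords X"
  using assms
  by (induction l and q rule: star_count_letter_star_count.induct)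
    (auto simp: bwords_iff[of _ "insert None (Some ` X)"] bwords_brk bwords_append
      UN_subset_iff bwords_Nil bwords_Gen)

text \<open>Exactly one factor of a product contains the star, and the others are constant by
  \<open>plug_star_free\<close>. One use of compatibility per level of the context therefore
  suffices, which also covers irreflexive relations.\<close>

lemma plug_compatible:
  assumes "op_compatible X R" "t \<in> bwords X" "v \<in> bwords X" "(t, v) \<in> R"
  shows "set_letter l \<subseteq> insert None (Some ` X) \<Longrightarrow> star_count_letter l = 1 \<Longrightarrow>
      (plug_letter l t, plug_letter l v) \<in> R"
    and "q \<in> bwords (insert None (Some ` X)) \<Longrightarrow> star_count q = 1 \<Longrightarrow>
      (plug q t, plug q v) \<in> R"
proof (induction l and q rule: star_count_letter_star_count.induct)
  case (3 w)
  then have "w \<in> bwords (insert None (Some ` X))"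
    by (auto simp: bwords_iff)
  \<comment> \<open>The bracket clause of \<open>op_compatible\<close> lies under the quantifier
    over \<open>c\<close>; \<open>bwords_Nil\<close> supplies a word to instantiate it.\<close>
  with 3 assms(1) plug_bwords(2)[OF assms(2)] plug_bwords(2)[OF assms(3)] bwords_Nil show ?case
    by (simp add: op_compatible_def) blast
next
  case (5 l w)
  then have w: "w \<in> bwords (insert None (Some ` X))" and l: "set_letter l \<subseteq> insert None (Some ` X)"
    by (auto simp: bwords_iff)
  note in_bwords = plug_bwords(1)[OF assms(2) l] plug_bwords(1)[OF assms(3) l]
    plug_bwords(2)[OF assms(2) w] plug_bwords(2)[OF assms(3) w]
  consider "star_count_letter l = 1" "star_count w = 0"
    | "star_count_letter l = 0" "star_count w = 1"
    using 5 by fastforce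
  then show ?case
  proof cases
    case 1
    with 5 l in_bwords assms(1) plug_star_free(2)[of w t v] show ?thesis
      by (simp add: op_compatible_def)
  next
    case 2
    with 5 w in_bwords assms(1) plug_star_free(1)[of l t v] show ?thesis
      by (simp add: op_compatible_def)
  qed
qed (use assms in auto)

text \<open>By \<open>plug_compatible\<close>, a compatible relation containing the oriented pairs
  contains all their instances in contexts. It is applied to the full relation on
  \<open>bwords X\<close>, to the reversed strict order and to congruences containing
  \<open>S\<close>.\<close>

lemma rewrite_system_least:
  assumes "S \<subseteq> bwords X \<times> bwords X" "op_compatible X R"
    and "\<And>t v. (t, v) \<in> S \<union> S\<inverse> \<Longrightarrow> less_in le v t \<Longrightarrow> (t, v) \<in> R"
  shows "rewrite_system X le S \<subseteq> R"
proof -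
  have "(plug q t, plug q v) \<in> R"
    if "q \<in> star_bwords X" "(t, v) \<in> S \<union> S\<inverse>" "less_in le v t" for q t v
    using plug_compatible(2)[of X R t v q] that assms by (auto simp: star_bwords_def)
  then show ?thesis
    unfolding rewrite_system_def by blast
qed

lemma rewrite_system_bwords:
  assumes "S \<subseteq> bwords X \<times> bwords X"
  shows "rewrite_system X le S \<subseteq> bwords X \<times> bwords X"
  using assms
  by (intro rewrite_system_least) (auto simp: op_compatible_def bwords_append bwords_brk)

text \<open>The monomial axioms say precisely that the strict order, hence its converse, is
  compatible.\<close>

lemma rewrite_system_descends:
  assumes "S \<subseteq> bwords X \<times> bwords X" "monomial_order X le"
  shows "rewrite_system X le S \<subseteq> (le - Id)\<inverse>"
  using assms
  by (intro rewrite_system_least)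
    (auto simp: op_compatible_def monomial_order_def less_in_def)

text \<open>Contexts compose: multiplying or bracketing both sides of a step amounts to multiplying
  or bracketing its context.\<close>

lemma op_compatible_rewrite_system: "op_compatible X (rewrite_system X le S)"
  unfolding op_compatible_def
proof (intro ballI impI conjI)
  fix a b c assume c: "c \<in> bwords X" and "(a, b) \<in> rewrite_system X le S"
  then obtain q t v where ab: "a = plug q t" "b = plug q v" "q \<in> star_bwords X"
    "(t, v) \<in> S \<union> S\<inverse>" "less_in le v t"
    unfolding rewrite_system_def by blast
  have step: "(plug p t, plug p v) \<in> rewrite_system X le S" if "p \<in> star_bwords X" for p
    using that ab unfolding rewrite_system_def by blast
  show "(a @ c, b @ c) \<in> rewrite_system X le S"
    using step[OF star_bwords_append_right[OF ab(3) c]] ab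
    by (simp add: plug_append plug_embed)
  show "(c @ a, c @ b) \<in> rewrite_system X le S"
    using step[OF star_bwords_append_left[OF ab(3) c]] ab
    by (simp add: plug_append plug_embed)
  show "(brk a, brk b) \<in> rewrite_system X le S"
    using step[OF star_bwords_brk[OF ab(3)]] ab
    by (simp add: brk_def)
qed

text \<open>Each link of a chain is transported separately; the bound on \<open>R\<close> keeps the
  intermediate words in \<open>bwords X\<close>, where compatibility applies.\<close>

lemma op_compatible_rtrancl:
  assumes "op_compatible X R" "R \<subseteq> bwords X \<times> bwords X"
  shows "op_compatible X (R\<^sup>*)"
  unfolding op_compatible_def
proof (intro ballI impI)
  fix a b c assume c: "c \<in> bwords X" and "(a, b) \<in> R\<^sup>*"
  from this(2) show "(a @ c, b @ c) \<in> R\<^sup>* \<and> (c @ a, c @ b) \<in> R\<^sup>* \<and> (brk a, brk b) \<in> R\<^sup>*"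
  proof (induction rule: rtrancl_induct)
    case base
    show ?case by simp
  next
    case (step y z)
    then have "(y @ c, z @ c) \<in> R \<and> (c @ y, c @ z) \<in> R \<and> (brk y, brk z) \<in> R"
      using assms c unfolding op_compatible_def by blast
    with step show ?case by (meson rtrancl.rtrancl_into_rtrancl)
  qed
qed

text \<open>The intersection removes the pairs \<open>(w, w)\<close> outside
  \<open>bwords X\<close>, which the reflexive closure over the whole type adds.\<close>

lemma generated_congruence_eq:
  assumes "S \<subseteq> bwords X \<times> bwords X" "monomial_order X le"
  defines "P \<equiv> rewrite_system X le S"
  shows "generated_congruence X S = (P \<union> P\<inverse>)\<^sup>* \<inter> bwords X \<times> bwords X"
    (is "_ = ?E")
proof
  have P: "P \<subseteq> bwords X \<times> bwords X"
    unfolding P_def by (rule rewrite_system_bwords[OF assms(1)])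
  have "equiv (bwords X) ?E"
  proof (rule equivI)
    show "sym ?E"
      by (rule symI) (auto intro: symD[OF sym_rtrancl[OF sym_Un_converse]])
    show "trans ?E"
      by (rule transI) auto
  qed (auto simp: refl_on_def)
  moreover have "op_compatible X ?E"
  proof -
    have "op_compatible X (P \<union> P\<inverse>)"
      using op_compatible_rewrite_system[of X le S]
      unfolding op_compatible_def P_def by blast
    then have "op_compatible X ((P \<union> P\<inverse>)\<^sup>*)"
      using P by (intro op_compatible_rtrancl) auto
    then show ?thesis
      by (simp add: op_compatible_def bwords_append bwords_brk)
  qed
  moreover have "S \<subseteq> ?E"
  proof
    fix p assume p: "p \<in> S"
    obtain t v where tv: "p = (t, v)" by fastforce
    have "t = v \<or> less_in le v t \<or> less_in le t v"
      using assms(1,2) p tv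
      by (auto simp: monomial_order_def well_order_on_def linear_order_on_def total_on_def
          less_in_def)
    \<comment> \<open>The bare star is the trivial context, so an oriented pair is itself a
      rewriting step.\<close>
    moreover have "(a, b) \<in> P" if "(a, b) \<in> S \<union> S\<inverse>" "less_in le b a" for a b
    proof -
      have "(plug [Gen None] a, plug [Gen None] b) \<in> P"
        using that star_bwords_star unfolding P_def rewrite_system_def by blast
      then show ?thesis by simp
    qed
    ultimately have "(t, v) \<in> (P \<union> P\<inverse>)\<^sup>*"
      using p tv by auto
    then show "p \<in> ?E"
      using assms(1) p tv by auto
  qed
  ultimately show "generated_congruence X S \<subseteq> ?E"
    unfolding generated_congruence_def operated_congruence_iff by blast
  show "?E \<subseteq> generated_congruence X S"
    unfolding generated_congruence_def
  proof (intro Inter_greatest, clarify)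
    fix R a b
    assume R: "operated_congruence X R" "S \<subseteq> R" and ab: "a \<in> bwords X" "(a, b) \<in> (P \<union> P\<inverse>)\<^sup>*"
    have eq: "equiv (bwords X) R"
      using R by (simp add: operated_congruence_def)
    then have "sym R" "trans R"
      by (auto elim: equivE)
    \<comment> \<open>A rule may come from \<open>S\<inverse>\<close>; symmetry of \<open>R\<close>
      puts it in \<open>R\<close> as well.\<close>
    have "P \<subseteq> R"
      unfolding P_def using R \<open>sym R\<close>
      by (intro rewrite_system_least[OF assms(1)]) (auto simp: operated_congruence_iff dest: symD)
    with \<open>sym R\<close> have "P \<union> P\<inverse> \<subseteq> R"
      by (auto dest: symD)
    from ab(2) show "(a, b) \<in> R"
    proof (induction rule: rtrancl_induct)
      case base
      show ?case using eq ab(1) by (auto elim!: equivE dest: refl_onD)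
    next
      case (step y z)
      with \<open>P \<union> P\<inverse> \<subseteq> R\<close> \<open>trans R\<close> show ?case by (meson subsetD transD)
    qed
  qed
qed

section \<open>Confluence and normal forms of abstract relations\<close>

lemma confluent_Church_Rosser:
  assumes "confluent P" "(a, b) \<in> (P \<union> P\<inverse>)\<^sup>*"
  shows "joinable P a b"
  using assms(2)
proof (induction rule: rtrancl_induct)
  case base
  show ?case by (auto simp: joinable_def)
next
  case (step y z)
  then obtain h where h: "(a, h) \<in> P\<^sup>*" "(y, h) \<in> P\<^sup>*"
    by (auto simp: joinable_def)
  show ?case
  proof (cases "(y, z) \<in> P")
    case True
    \<comment> \<open>Here \<open>y\<close> reduces both to \<open>h\<close> and to
      \<open>z\<close>, so confluence joins these two.\<close>
    then have "joinable P h z"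
      using assms(1) h(2) unfolding confluent_def by blast
    with h(1) show ?thesis
      unfolding joinable_def by (meson rtrancl_trans)
  next
    case False
    \<comment> \<open>For a backward step, \<open>z\<close> reduces through \<open>y\<close> to
      \<open>h\<close>, so the old common reduct still serves.\<close>
    with step.hyps(2) have "(z, y) \<in> P"
      by blast
    with h show ?thesis
      unfolding joinable_def by (meson converse_rtrancl_into_rtrancl)
  qed
qed

lemma ex_normal_form:
  assumes "wf (P\<inverse>)"
  shows "\<exists>g. (f, g) \<in> P\<^sup>* \<and> g \<notin> Domain P"
  using assms
proof (induction f rule: wf_induct_rule)
  case (less f)
  then show ?case
    by (cases "f \<in> Domain P") (blast intro: converse_rtrancl_into_rtrancl)+
qed

lemma terminating_if_wf: "wf (P\<inverse>) \<Longrightarrow> terminating P"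
  by (auto simp: terminating_def wf_iff_no_infinite_down_chain)

text \<open>An irreducible element reduces only to itself, so a common reduct equals both.\<close>

lemma normal_form_unique:
  assumes "joinable P f g" "f \<notin> Domain P" "g \<notin> Domain P"
  shows "f = g"
  using assms unfolding joinable_def by (metis Domain.DomainI converse_rtranclE)

section \<open>Sections and convergence\<close>

theorem theorem2p21:
  fixes X :: "'x set" and S le :: "'x bword rel"
  assumes "S \<subseteq> bwords X \<times> bwords X"
    and "monomial_order X le"
  shows "is_section X (generated_congruence X S) (Irr X le S) \<longleftrightarrow>
    convergent (rewrite_system X le S)"
proof -
  define P where "P = rewrite_system X le S"
  let ?E = "(P \<union> P\<inverse>)\<^sup>* \<inter> bwords X \<times> bwords X"
  have P: "P \<subseteq> bwords X \<times> bwords X"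
    unfolding P_def by (rule rewrite_system_bwords[OF assms(1)])
  have "wf (le - Id)"
    using assms(2) by (simp add: monomial_order_def well_order_on_def)
  then have wf: "wf (P\<inverse>)"
    using rewrite_system_descends[OF assms] unfolding P_def by (elim wf_subset) auto
  have closed: "g \<in> bwords X" if "(f, g) \<in> P\<^sup>*" "f \<in> bwords X" for f g
    using that P by (induction rule: rtrancl_induct) auto
  have rtrancl_sub: "P\<^sup>* \<subseteq> (P \<union> P\<inverse>)\<^sup>*"
    by (rule rtrancl_mono) auto
  have sym: "(b, a) \<in> (P \<union> P\<inverse>)\<^sup>*" if "(a, b) \<in> (P \<union> P\<inverse>)\<^sup>*" for a b
    using that by (rule symD[OF sym_rtrancl[OF sym_Un_converse]])
  \<comment> \<open>Every class is the image of some \<open>f\<close> under the congruence, so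
    quantifying over classes becomes quantifying over representatives.\<close>
  have section_iff: "is_section X (generated_congruence X S) (Irr X le S) \<longleftrightarrow>
      (\<forall>f \<in> bwords X. \<exists>!w. (f, w) \<in> ?E \<and> w \<in> bwords X \<and> w \<notin> Domain P)"
    unfolding generated_congruence_eq[OF assms] P_def[symmetric] is_section_def Irr_def quotient_def
    by simp
  show ?thesis
    unfolding section_iff unfolding P_def[symmetric]
  proof
    assume unique: "\<forall>f \<in> bwords X. \<exists>!w. (f, w) \<in> ?E \<and> w \<in> bwords X \<and> w \<notin> Domain P"
    have "joinable P g h" if fgh: "(f, g) \<in> P\<^sup>*" "(f, h) \<in> P\<^sup>*" for f g h
    proof (cases "f \<in> bwords X")
      case True
      obtain g' where g': "(g, g') \<in> P\<^sup>*" "g' \<notin> Domain P"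
        using ex_normal_form[OF wf] by blast
      obtain h' where h': "(h, h') \<in> P\<^sup>*" "h' \<notin> Domain P"
        using ex_normal_form[OF wf] by blast
      \<comment> \<open>Both normal forms lie in the class of \<open>f\<close>; the section property
        identifies them, which gives the common reduct of \<open>g\<close> and
        \<open>h\<close>.\<close>
      have "(f, g') \<in> P\<^sup>*" "(f, h') \<in> P\<^sup>*"
        using fgh g' h' by (auto intro: rtrancl_trans)
      then have "(f, g') \<in> ?E" "(f, h') \<in> ?E"
        using closed[OF _ True] rtrancl_sub True by auto
      then have "g' = h'"
        using unique True g'(2) h'(2) by blast
      with g' h' show ?thesis
        by (auto simp: joinable_def)
    next
      case False
      \<comment> \<open>Confluence ranges over the whole type, but an \<open>f\<close> outside
        \<open>bwords X\<close> reduces only to itself.\<close>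
      then have "f \<notin> Domain P"
        using P by auto
      then have "g = f" "h = f"
        using fgh by (auto elim: converse_rtranclE)
      then show ?thesis
        by (auto simp: joinable_def)
    qed
    then show "convergent P"
      using terminating_if_wf[OF wf] by (simp add: convergent_def confluent_def)
  next
    assume conv: "convergent P"
    show "\<forall>f \<in> bwords X. \<exists>!w. (f, w) \<in> ?E \<and> w \<in> bwords X \<and> w \<notin> Domain P"
    proof
      fix f assume f: "f \<in> bwords X"
      obtain w where w: "(f, w) \<in> P\<^sup>*" "w \<notin> Domain P"
        using ex_normal_form[OF wf] by blast
      show "\<exists>!w. (f, w) \<in> ?E \<and> w \<in> bwords X \<and> w \<notin> Domain P"
      proof (rule ex1I[of _ w])
        show "(f, w) \<in> ?E \<and> w \<in> bwords X \<and> w \<notin> Domain P"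
          using w f closed rtrancl_sub by auto
        fix v assume v: "(f, v) \<in> ?E \<and> v \<in> bwords X \<and> v \<notin> Domain P"
        \<comment> \<open>Going back from \<open>v\<close> to \<open>f\<close> and then down to
          \<open>w\<close> gives a conversion, which Church-Rosser makes joinable.\<close>
        have "(v, w) \<in> (P \<union> P\<inverse>)\<^sup>*"
          using v w(1) sym rtrancl_sub by (blast intro: rtrancl_trans)
        then have "joinable P v w"
          using conv by (intro confluent_Church_Rosser) (simp_all add: convergent_def)
        then show "v = w"
          using v w(2) by (intro normal_form_unique) auto
      qed
    qed
  qed
qed

end
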